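(* Let $A\in\mathbb{C}^{m\times n}$ have no zero rows, let $b\in\mathbb{C}^m$, and suppose the linear system $Ax=b$ is consistent. Let $x_\ast=A^\dagger b$ and $\rho=\sigma_r^2(A)/\|A\|_F^2$. Let $0<\alpha<2$, put $\tau_1=4+\alpha-\alpha\rho$ and $\tau_2=\alpha(2-\alpha)\rho$, and let $$0<\beta<\frac{\sqrt{\tau_1^2+12\tau_2}-\tau_1}{6}.$$ Define $$\gamma_1=(1+3\beta+\beta^2)+(\alpha^2-2\alpha-\alpha\beta)\rho,\qquad \gamma_2=2\beta^2+(1+\alpha)\beta.$$ Then $\gamma_1+\gamma_2<1$, and the sequence $\{x^{(k)}\}_{k\ge0}$ generated by the mMWRK method with parameters $\alpha,\beta$ from any initial vectors $x^{(0)}=x^{(1)}$ in the column space of $A^\ast$ satisfies, for every $k\ge 0$, $$\|x^{(k+1)}-x_\ast\|^2\le\left(\frac{\sqrt{\gamma_1^2+4\gamma_2}+\gamma_1}{2}\right)^k\left(1+\frac{\sqrt{\gamma_1^2+4\gamma_2}-\gamma_1}{2}\right)\|x^{(0)}-x_\ast\|^2,$$ where the convergence factor satisfies $\dfrac{\sqrt{\gamma_1^2+4\gamma_2}+\gamma_1}{2}<1$.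
   Context: Notation: $[m]=\{1,\dots,m\}$; $A_{i,:}$ is the $i$-th row of $A$; $(\cdot)^\ast$ is the conjugate transpose; $A^\dagger$ is the Moore–Penrose pseudoinverse; $\|\cdot\|$ is the Euclidean norm and $\|\cdot\|_F$ the Frobenius norm; $\sigma_r(A)$ is the smallest nonzero singular value of $A$. For $x\in\mathbb{C}^n$ and $i\in[m]$, $$\psi_i(x)=\frac{|b_i-A_{i,:}x|^2}{\|A_{i,:}\|^2}.$$ The mMWRK method (maximal weighted residual Kaczmarz with momentum), with step-size $\alpha$ and momentum parameter $\beta$: given $x^{(0)},x^{(1)}$, for $k=1,2,\dots$ choose an index $i_k\in\arg\max_{i\in[m]}\psi_i(x^{(k)})$ and set $$x^{(k+1)}=x^{(k)}+\alpha\,\frac{b_{i_k}-A_{i_k,:}x^{(k)}}{\|A_{i_k,:}\|^2}\,A_{i_k,:}^\ast+\beta\,(x^{(k)}-x^{(k-1)}).$$ *)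

theory Defs
  imports "HOL-Analysis.Analysis"
begin

text \<open>
  An \<open>m \<times> n\<close> complex matrix has type \<open>complex ^ 'n ^ 'm\<close>. The library \<open>norm\<close> on \<open>complex ^ 'n\<close>
  is the Euclidean norm.
\<close>

definition ctranspose :: "complex ^ 'n ^ 'm \<Rightarrow> complex ^ 'm ^ 'n" where
  "ctranspose A = (\<chi> i j. cnj (A $ j $ i))"

definition frobenius_norm :: "complex ^ 'n ^ 'm \<Rightarrow> real" where
  "frobenius_norm A = sqrt (\<Sum>i\<in>UNIV. \<Sum>j\<in>UNIV. (cmod (A $ i $ j))\<^sup>2)"

definition is_pseudoinverse :: "complex ^ 'n ^ 'm \<Rightarrow> complex ^ 'm ^ 'n \<Rightarrow> bool" where
  "is_pseudoinverse A X \<longleftrightarrow>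
     A ** X ** A = A \<and> X ** A ** X = X \<and>
     ctranspose (A ** X) = A ** X \<and> ctranspose (X ** A) = X ** A"

text \<open>The four Penrose equations have exactly one solution for every matrix.\<close>

definition pseudoinverse :: "complex ^ 'n ^ 'm \<Rightarrow> complex ^ 'm ^ 'n" where
  "pseudoinverse A = (THE X. is_pseudoinverse A X)"

text \<open>Singular values are the nonnegative square roots of the eigenvalues of \<open>A\<^sup>* A\<close>.\<close>

definition singular_values :: "complex ^ 'n ^ 'm \<Rightarrow> real set" where
  "singular_values A =
     {s. s \<ge> 0 \<and> (\<exists>v. v \<noteq> 0 \<and> (ctranspose A ** A) *v v = complex_of_real (s\<^sup>2) *s v)}"

definition smallest_nonzero_singular_value :: "complex ^ 'n ^ 'm \<Rightarrow> real" where
  "smallest_nonzero_singular_value A = Min (singular_values A - {0})"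

definition column_space :: "complex ^ 'n ^ 'm \<Rightarrow> (complex ^ 'm) set" where
  "column_space A = range (\<lambda>y. A *v y)"

definition weighted_residual ::
    "complex ^ 'n ^ 'm \<Rightarrow> complex ^ 'm \<Rightarrow> complex ^ 'n \<Rightarrow> 'm \<Rightarrow> real" where
  "weighted_residual A b x i = (cmod (b $ i - (A *v x) $ i))\<^sup>2 / (norm (row i A))\<^sup>2"

text \<open>
  \<open>mMWRK A b \<alpha> \<beta> x\<close>: \<open>x\<close> is a possible run of the method, where ties in the maximum may be
  broken arbitrarily. The column vector \<open>column i (ctranspose A)\<close> is the conjugate transpose of
  the \<open>i\<close>-th row of \<open>A\<close>.
\<close>

definition mMWRK ::
    "complex ^ 'n ^ 'm \<Rightarrow> complex ^ 'm \<Rightarrow> real \<Rightarrow> real \<Rightarrow> (nat \<Rightarrow> complex ^ 'n) \<Rightarrow> bool" where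
  "mMWRK A b \<alpha> \<beta> x \<longleftrightarrow>
     (\<forall>k\<ge>1. \<exists>i. is_arg_max (weighted_residual A b (x k)) (\<lambda>i. i \<in> UNIV) i \<and>
        x (k + 1) = x k
          + \<alpha> *\<^sub>R (((b $ i - (A *v x k) $ i) / complex_of_real ((norm (row i A))\<^sup>2))
                     *s column i (ctranspose A))
          + \<beta> *\<^sub>R (x k - x (k - 1)))"

end

theory Submission imports Defs begin

text \<open>
  Write \<open>e\<^sub>k = x\<^sub>k - x\<^sub>*\<close>, let \<open>p\<close> be the projection of \<open>e\<^sub>k\<close> onto the line spanned by
  the selected row and \<open>q = e\<^sub>k - p\<close>. Then \<open>e\<^sub>k\<^sub>+\<^sub>1 = (1 + \<beta> - \<alpha>) p + (1 + \<beta>) q - \<beta> e\<^sub>k\<^sub>-\<^sub>1\<close>. All errors lie in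
  the range of \<open>A\<^sup>*\<close>, so the greedy choice of the row gives \<open>\<rho> \<parallel>e\<^sub>k\<parallel>\<^sup>2 \<le> \<parallel>p\<parallel>\<^sup>2\<close>, and hence
  \<open>\<parallel>e\<^sub>k\<^sub>+\<^sub>1\<parallel>\<^sup>2 \<le> \<gamma>1 \<parallel>e\<^sub>k\<parallel>\<^sup>2 + \<gamma>2 \<parallel>e\<^sub>k\<^sub>-\<^sub>1\<parallel>\<^sup>2\<close>. Expanding the momentum term and estimating
  \<open>2 |\<langle>e\<^sub>k, e\<^sub>k\<^sub>-\<^sub>1\<rangle>| \<le> \<parallel>e\<^sub>k\<parallel>\<^sup>2 + \<parallel>e\<^sub>k\<^sub>-\<^sub>1\<parallel>\<^sup>2\<close> would only give \<open>2\<beta>\<^sup>2\<close> in place of \<open>\<beta>\<^sup>2\<close> in \<open>\<gamma>1\<close>;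
  completing the square in \<open>e\<^sub>k\<^sub>-\<^sub>1\<close> while keeping \<open>p\<close> and \<open>q\<close> separate recovers the stated
  constant, because the bound on \<open>\<beta>\<close> forces \<open>\<beta> + \<beta>\<^sup>2 \<le> \<alpha>\<close>.
\<close>

subsection \<open>Conjugate transposes\<close>

lemma ctranspose_ctranspose [simp]: "ctranspose (ctranspose A) = A"
  by (simp add: ctranspose_def vec_eq_iff)

lemma ctranspose_matrix_mult: "ctranspose (A ** B) = ctranspose B ** ctranspose A"
  by (simp add: ctranspose_def matrix_matrix_mult_def vec_eq_iff mult.commute)

lemma of_real_vector_smult: "complex_of_real c *s v = c *\<^sub>R v"
  by (simp add: vec_eq_iff scaleR_conv_of_real[where 'a = complex])

text \<open>The inner product on complex vectors used here is the real part of the Hermitian one.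
  That is enough, because norms and the adjoint identity below involve only real parts.\<close>

lemma inner_complex_Re: "(w :: complex) \<bullet> z = Re (w * cnj z)"
  by (simp add: inner_complex_def)

lemma inner_ctranspose: "(A *v x) \<bullet> y = x \<bullet> (ctranspose A *v y)"
proof -
  have "(A *v x) \<bullet> y = (\<Sum>i\<in>UNIV. \<Sum>j\<in>UNIV. Re (A $ i $ j * x $ j * cnj (y $ i)))"
    by (simp add: inner_vec_def matrix_vector_mult_def inner_complex_Re sum_distrib_right
        del: times_complex.sel)
  also have "\<dots> = (\<Sum>j\<in>UNIV. \<Sum>i\<in>UNIV. Re (A $ i $ j * x $ j * cnj (y $ i)))"
    by (rule sum.swap)
  also have "\<dots> = x \<bullet> (ctranspose A *v y)"
    by (simp add: inner_vec_def matrix_vector_mult_def inner_complex_Re ctranspose_def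
        sum_distrib_left mult_ac del: times_complex.sel)
  finally show ?thesis .
qed

lemma inner_gram: "((ctranspose A ** A) *v v) \<bullet> w = (A *v v) \<bullet> (A *v w)"
  by (simp add: inner_ctranspose flip: matrix_vector_mul_assoc)

lemma gram_self_adjoint:
  "((ctranspose A ** A) *v v) \<bullet> w = v \<bullet> ((ctranspose A ** A) *v w)"
  using inner_gram[of A v w] inner_gram[of A w v] by (simp add: inner_commute)

text \<open>Real linearity gives access to real subspaces, orthogonal decomposition and
  continuity.\<close>

lemma linear_complex_matrix [simp]: "linear (\<lambda>x. (A :: complex ^ 'n ^ 'm) *v x)"
  by (rule linearI) (simp_all add: matrix_vector_mult_def vec_eq_iff scaleR_sum_right
      distrib_left sum.distrib)

lemma subspace_column_space: "subspace (column_space A)"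
  unfolding column_space_def by (rule linear_subspace_image) (auto simp: subspace_UNIV)

lemma matrix_vector_mult_axis: "(A :: complex ^ 'n ^ 'm) *v axis i c = c *s column i A"
  by (simp add: vec_eq_iff matrix_vector_mult_def axis_def column_def if_distrib mult.commute
      cong: if_cong)

subsection \<open>The pseudoinverse\<close>

text \<open>Least squares: the component of \<open>c\<close> orthogonal to the column space is
  annihilated by \<open>ctranspose A\<close>.\<close>

lemma normal_equation_solvable: "\<exists>y. ctranspose A *v (A *v y) = ctranspose A *v c"
proof -
  have "span (column_space A) = column_space A"
    using subspace_column_space span_eq_iff by blast
  then obtain u z where "u \<in> column_space A" and z: "\<And>w. w \<in> column_space A \<Longrightarrow> orthogonal z w"
    and c: "c = u + z"
    using orthogonal_subspace_decomp_exists[of "column_space A" c] by metis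
  then obtain y where u: "u = A *v y" by (auto simp: column_space_def)
  have "(A *v w) \<bullet> z = 0" for w
    using z[of "A *v w"] by (simp add: column_space_def orthogonal_def inner_commute)
  \<comment> \<open>Take \<open>w = ctranspose A *v z\<close> and move \<open>A\<close> across the
    inner product.\<close>
  then have "(ctranspose A *v z) \<bullet> (ctranspose A *v z) = 0"
    by (metis inner_ctranspose)
  then show ?thesis
    using c u by (auto simp: matrix_vector_right_distrib)
qed

lemma matrix_normal_equation_solvable: "\<exists>Y. ctranspose A ** A ** Y = ctranspose A"
proof -
  have "\<forall>j. \<exists>y. ctranspose A *v (A *v y) = ctranspose A *v axis j 1"
    using normal_equation_solvable by blast
  from choice[OF this] obtain y
    where y: "\<forall>j. ctranspose A *v (A *v y j) = ctranspose A *v axis j 1" ..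
  have "(ctranspose A ** A ** (\<chi> i j. y j $ i)) *v axis j 1 = ctranspose A *v axis j 1" for j
  proof -
    have "(\<chi> i j. y j $ i) *v axis j 1 = y j"
      by (simp add: matrix_vector_mult_axis column_def vec_eq_iff)
    then show ?thesis
      by (simp add: y flip: matrix_vector_mul_assoc)
  qed
  then have "column j (ctranspose A ** A ** (\<chi> i j. y j $ i)) = column j (ctranspose A)" for j
    by (simp add: matrix_vector_mult_axis)
  then show ?thesis
    by (intro exI[of _ "\<chi> i j. y j $ i"]) (auto simp: column_def vec_eq_iff)
qed

text \<open>Take \<open>Y\<close> from the matrix normal equation. Multiplying it by
  \<open>ctranspose Y\<close> on the left equates \<open>ctranspose (A ** Y)\<close> with a
  Hermitian matrix; taking its adjoint then gives \<open>A ** Y ** A = A\<close>.\<close>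

lemma hermitian_inner_inverse_exists: "\<exists>Y. A ** Y ** A = A \<and> ctranspose (A ** Y) = A ** Y"
proof -
  obtain Y where Y: "ctranspose A ** A ** Y = ctranspose A"
    using matrix_normal_equation_solvable by blast
  have "ctranspose (A ** Y) ** (A ** Y) = ctranspose (A ** Y)"
    by (metis Y ctranspose_matrix_mult matrix_mul_assoc)
  then have h: "ctranspose (A ** Y) = A ** Y"
    by (metis ctranspose_ctranspose ctranspose_matrix_mult)
  have "ctranspose (A ** Y) ** A = ctranspose (ctranspose A ** A ** Y)"
    by (simp add: ctranspose_matrix_mult matrix_mul_assoc)
  then have "A ** Y ** A = A"
    unfolding h Y by simp
  then show ?thesis using h by blast
qed

text \<open>The witness is \<open>Z ** A ** Y\<close>, where \<open>Y\<close> is an inner inverse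
  with \<open>A ** Y\<close> Hermitian and \<open>Z\<close>, obtained from
  \<open>ctranspose A\<close>, is one with \<open>Z ** A\<close> Hermitian. Its products with
  \<open>A\<close> collapse to \<open>A ** Y\<close> and \<open>Z ** A\<close>.\<close>

lemma pseudoinverse_exists: "\<exists>X. is_pseudoinverse A X"
proof -
  obtain Y where Y: "A ** Y ** A = A" "ctranspose (A ** Y) = A ** Y"
    using hermitian_inner_inverse_exists by blast
  obtain W where W: "ctranspose A ** W ** ctranspose A = ctranspose A"
      "ctranspose (ctranspose A ** W) = ctranspose A ** W"
    using hermitian_inner_inverse_exists by blast
  define Z where "Z = ctranspose W"
  have "A ** Z ** A = ctranspose (ctranspose A ** W ** ctranspose A)"
    by (simp add: Z_def ctranspose_matrix_mult matrix_mul_assoc)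
  then have Z1: "A ** Z ** A = A"
    unfolding W by simp
  have "Z ** A = ctranspose (ctranspose A ** W)"
    by (simp add: Z_def ctranspose_matrix_mult)
  then have Z2: "ctranspose (Z ** A) = Z ** A"
    unfolding W(2) by (metis W(2))
  have "A ** (Z ** A ** Y) = (A ** Z ** A) ** Y" by (simp only: matrix_mul_assoc)
  then have AX: "A ** (Z ** A ** Y) = A ** Y" unfolding Z1 .
  have "(Z ** A ** Y) ** A = Z ** (A ** Y ** A)" by (simp only: matrix_mul_assoc)
  then have XA: "(Z ** A ** Y) ** A = Z ** A" unfolding Y(1) .
  have "Z ** A ** (Z ** A ** Y) = Z ** (A ** Z ** A) ** Y" by (simp only: matrix_mul_assoc)
  then have XAX: "Z ** A ** (Z ** A ** Y) = Z ** A ** Y" unfolding Z1 .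
  have "is_pseudoinverse A (Z ** A ** Y)"
    unfolding is_pseudoinverse_def XA AX XAX using Y Z2 by blast
  then show ?thesis ..
qed

text \<open>\<open>A ** X\<close> and \<open>A ** Y\<close> are Hermitian projections with the same
  range, so each absorbs the other and adjoints equate them. The same works for
  \<open>X ** A\<close> and \<open>Y ** A\<close>.\<close>

lemma pseudoinverse_unique:
  assumes "is_pseudoinverse A X" "is_pseudoinverse A Y"
  shows "X = Y"
proof -
  note X = assms(1)[unfolded is_pseudoinverse_def] and Y = assms(2)[unfolded is_pseudoinverse_def]
  have "A ** X = (A ** Y) ** (A ** X)" using Y by (simp add: matrix_mul_assoc)
  also have "\<dots> = ctranspose ((A ** X) ** (A ** Y))"
    using X Y by (metis ctranspose_matrix_mult)
  also have "\<dots> = A ** Y" using X Y by (simp add: matrix_mul_assoc)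
  finally have 1: "A ** X = A ** Y" .
  have "X ** A = (X ** A) ** (Y ** A)" using Y by (metis matrix_mul_assoc)
  also have "\<dots> = ctranspose ((Y ** A) ** (X ** A))"
    using X Y by (metis ctranspose_matrix_mult)
  also have "(Y ** A) ** (X ** A) = Y ** A" using X by (metis matrix_mul_assoc)
  finally have 2: "X ** A = Y ** A" using Y by simp
  show ?thesis using X Y 1 2 by (metis matrix_mul_assoc)
qed

lemma is_pseudoinverse_pseudoinverse: "is_pseudoinverse A (pseudoinverse A)"
proof -
  obtain X where X: "is_pseudoinverse A X" using pseudoinverse_exists by blast
  show ?thesis
    unfolding pseudoinverse_def by (rule theI[of "is_pseudoinverse A", OF X]) (rule pseudoinverse_unique[OF _ X])
qed

lemma pseudoinverse_solves:
  assumes "A *v x = b"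
  shows "A *v (pseudoinverse A *v b) = b"
proof -
  have "A ** pseudoinverse A ** A = A"
    using is_pseudoinverse_pseudoinverse[of A] unfolding is_pseudoinverse_def by blast
  then have "(A ** pseudoinverse A ** A) *v x = A *v x" by simp
  then show ?thesis by (simp add: assms flip: matrix_vector_mul_assoc)
qed

text \<open>Since \<open>X ** A\<close> is Hermitian, \<open>X = X ** A ** X\<close> factors through
  \<open>ctranspose A\<close> on the left. This places the errors of the method in the row
  space.\<close>

lemma pseudoinverse_mem_row_space: "pseudoinverse A *v b \<in> column_space (ctranspose A)"
proof -
  let ?X = "pseudoinverse A"
  have "?X = ctranspose (?X ** A) ** ?X"
    using is_pseudoinverse_pseudoinverse[of A] by (simp add: is_pseudoinverse_def)
  also have "\<dots> = ctranspose A ** (ctranspose ?X ** ?X)"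
    by (simp add: ctranspose_matrix_mult matrix_mul_assoc)
  finally have "?X *v b = ctranspose A *v ((ctranspose ?X ** ?X) *v b)"
    by (metis matrix_vector_mul_assoc)
  then show ?thesis by (auto simp: column_space_def)
qed

subsection \<open>The smallest nonzero singular value\<close>

text \<open>Eigenvectors of the self-adjoint Gram matrix for distinct eigenvalues are orthogonal,
  and squaring is injective on nonnegative reals. Finiteness gives \<open>Min\<close> its
  meaning.\<close>

lemma finite_singular_values: "finite (singular_values A)"
proof -
  have "\<forall>s\<in>singular_values A. \<exists>v. v \<noteq> 0 \<and> (ctranspose A ** A) *v v = s\<^sup>2 *\<^sub>R v"
    by (auto simp: singular_values_def simp flip: of_real_vector_smult)
  then obtain f where f0: "\<And>s. s \<in> singular_values A \<Longrightarrow> f s \<noteq> 0"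
    and f: "\<And>s. s \<in> singular_values A \<Longrightarrow> (ctranspose A ** A) *v f s = s\<^sup>2 *\<^sub>R f s"
    by metis
  have orth: "f s \<bullet> f t = 0" if "s \<in> singular_values A" "t \<in> singular_values A" "s \<noteq> t" for s t
  proof -
    have "s\<^sup>2 * (f s \<bullet> f t) = t\<^sup>2 * (f s \<bullet> f t)"
      using gram_self_adjoint[of A "f s" "f t"] f that by simp
    moreover have "s\<^sup>2 \<noteq> t\<^sup>2"
      using that by (auto simp: singular_values_def power2_eq_iff)
    ultimately show ?thesis by simp
  qed
  have "pairwise orthogonal (f ` singular_values A)"
    unfolding pairwise_def orthogonal_def using orth by blast
  then have "finite (f ` singular_values A)"
    by (rule pairwise_orthogonal_imp_finite)
  moreover have "inj_on f (singular_values A)"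
    using orth f0 by (metis inj_onI inner_eq_zero_iff)
  ultimately show ?thesis by (rule finite_imageD)
qed

lemma row_space_kernel:
  assumes "v \<in> column_space (ctranspose A)" "A *v v = 0"
  shows "v = 0"
proof -
  obtain y where "v = ctranspose A *v y" using assms(1) by (auto simp: column_space_def)
  then have "v \<bullet> v = 0"
    using assms(2) inner_ctranspose[of A v y] by (metis inner_zero_left)
  then show ?thesis by simp
qed

text \<open>Compactness of the unit sphere gives the minimizer, and scaling extends the bound.
  Restricting to the row space removes the kernel, so the minimum is not zero.\<close>

lemma rayleigh_minimum_on_row_space:
  assumes "column_space (ctranspose A) \<noteq> {0}"
  obtains v where "v \<in> column_space (ctranspose A)" "norm v = 1"
    "\<forall>w\<in>column_space (ctranspose A). (norm (A *v v))\<^sup>2 * (norm w)\<^sup>2 \<le> (norm (A *v w))\<^sup>2"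
proof -
  let ?S = "column_space (ctranspose A)"
  have S: "subspace ?S" by (rule subspace_column_space)
  have normalized: "(inverse (norm w)) *\<^sub>R w \<in> ?S \<inter> sphere 0 1" if "w \<in> ?S" "w \<noteq> 0" for w
    using that S by (simp add: subspace_scale)
  obtain w0 where "w0 \<in> ?S" "w0 \<noteq> 0"
    using assms subspace_0[OF S] by auto
  then have "?S \<inter> sphere 0 1 \<noteq> {}" using normalized by blast
  moreover have "compact (?S \<inter> sphere 0 1)"
    by (intro closed_Int_compact closed_subspace S compact_sphere)
  moreover have "continuous_on (?S \<inter> sphere 0 1) (\<lambda>v. norm (A *v v))"
    by (intro continuous_on_norm linear_continuous_on linear_linear[THEN iffD2] linear_complex_matrix)
  ultimately obtain v where v: "v \<in> ?S \<inter> sphere 0 1"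
    and min: "\<And>w. w \<in> ?S \<inter> sphere 0 1 \<Longrightarrow> norm (A *v v) \<le> norm (A *v w)"
    using continuous_attains_inf by metis
  have "(norm (A *v v))\<^sup>2 * (norm w)\<^sup>2 \<le> (norm (A *v w))\<^sup>2" if "w \<in> ?S" for w
  proof (cases "w = 0")
    case False
    have "norm (A *v v) \<le> norm (A *v w) / norm w"
      using min[OF normalized[OF that False]]
      by (simp add: linear_scale[OF linear_complex_matrix] divide_inverse mult.commute)
    then have "norm (A *v v) * norm w \<le> norm (A *v w)"
      using False by (simp add: field_simps)
    then show ?thesis
      by (metis mult_nonneg_nonneg norm_ge_zero power_mono power_mult_distrib)
  qed simp
  then show thesis using v that[of v] by simp
qed

lemma nonneg_quadratic_imp_linear_coeff_zero:
  fixes a c :: real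
  assumes "\<And>t. 0 \<le> a * t + c * t\<^sup>2"
  shows "a = 0"
proof (rule ccontr)
  assume "a \<noteq> 0"
  \<comment> \<open>This \<open>t\<close> has the sign opposite to \<open>a\<close> and is small
    enough for the linear term to dominate.\<close>
  have "0 \<le> a * (- a / (\<bar>c\<bar> + 1)) + c * (- a / (\<bar>c\<bar> + 1))\<^sup>2" by (rule assms)
  also have "\<dots> = a\<^sup>2 * (c - \<bar>c\<bar> - 1) / (\<bar>c\<bar> + 1)\<^sup>2"
    by (simp add: divide_simps) (simp add: power2_eq_square algebra_simps)
  also have "\<dots> < 0"
    using \<open>a \<noteq> 0\<close> by (intro divide_neg_pos mult_pos_neg) auto
  finally show False by simp
qed

lemma norm_add_scaleR_squared:
  fixes u w :: "'a :: real_inner"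
  shows "(norm (u + t *\<^sub>R w))\<^sup>2 = (norm u)\<^sup>2 + 2 * t * (u \<bullet> w) + t\<^sup>2 * (norm w)\<^sup>2"
  unfolding power2_norm_eq_inner
  by (simp add: inner_add_left inner_add_right inner_commute power2_eq_square)

text \<open>First variation at the minimum: perturb \<open>v\<close> along its own eigenvalue defect
  \<open>w\<close>, which stays in the row space. The linear coefficient is
  \<open>2 * (w \<bullet> w)\<close>, so \<open>w\<close> must vanish.\<close>

lemma rayleigh_minimizer_is_eigenvector:
  assumes v: "v \<in> column_space (ctranspose A)" "norm v = 1"
    and min: "\<forall>w\<in>column_space (ctranspose A).
      (norm (A *v v))\<^sup>2 * (norm w)\<^sup>2 \<le> (norm (A *v w))\<^sup>2"
  shows "(ctranspose A ** A) *v v = complex_of_real ((norm (A *v v))\<^sup>2) *s v"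
proof -
  let ?l = "(norm (A *v v))\<^sup>2" and ?S = "column_space (ctranspose A)"
  define w where "w = (ctranspose A ** A) *v v - ?l *\<^sub>R v"
  have S: "subspace ?S" by (rule subspace_column_space)
  have "(ctranspose A ** A) *v v \<in> ?S"
    by (auto simp: column_space_def simp flip: matrix_vector_mul_assoc)
  then have w: "w \<in> ?S" unfolding w_def using S v by (simp add: subspace_diff subspace_scale)
  have "0 \<le> (2 * (w \<bullet> w)) * t + ((norm (A *v w))\<^sup>2 - ?l * (norm w)\<^sup>2) * t\<^sup>2" for t
  proof -
    have "v + t *\<^sub>R w \<in> ?S" using S v w by (simp add: subspace_add subspace_scale)
    from bspec[OF min this] have
      "?l * (1 + 2 * t * (v \<bullet> w) + t\<^sup>2 * (w \<bullet> w))
        \<le> ?l + 2 * t * ((A *v v) \<bullet> (A *v w)) + t\<^sup>2 * (norm (A *v w))\<^sup>2"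
      using v(2)
      by (simp add: linear_add[OF linear_complex_matrix] linear_scale[OF linear_complex_matrix]
          norm_add_scaleR_squared) (simp add: power2_norm_eq_inner)
    moreover have "(A *v v) \<bullet> (A *v w) = w \<bullet> w + ?l * (v \<bullet> w)"
      by (simp add: w_def inner_gram[symmetric] inner_diff_left)
    ultimately show ?thesis by (simp add: power2_norm_eq_inner algebra_simps)
  qed
  then have "2 * (w \<bullet> w) = 0" by (rule nonneg_quadratic_imp_linear_coeff_zero)
  then show ?thesis by (simp add: w_def of_real_vector_smult del: of_real_power)
qed

text \<open>The Rayleigh minimum is attained at an eigenvector, so it is the square of a nonzero
  singular value, which is at least \<open>Min\<close>.\<close>

lemma smallest_nonzero_singular_value_bound:
  assumes "w \<in> column_space (ctranspose A)"
  shows "(smallest_nonzero_singular_value A)\<^sup>2 * (norm w)\<^sup>2 \<le> (norm (A *v w))\<^sup>2"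
proof (cases "w = 0")
  case False
  then have "column_space (ctranspose A) \<noteq> {0}" using assms by auto
  then obtain v where v: "v \<in> column_space (ctranspose A)" "norm v = 1"
    and min: "\<forall>u\<in>column_space (ctranspose A).
      (norm (A *v v))\<^sup>2 * (norm u)\<^sup>2 \<le> (norm (A *v u))\<^sup>2"
    by (rule rayleigh_minimum_on_row_space)
  let ?s = "norm (A *v v)" and ?T = "singular_values A - {0}"
  have "v \<noteq> 0" using v by auto
  then have "?s \<in> ?T"
    using rayleigh_minimizer_is_eigenvector[OF v min] row_space_kernel[OF v(1)]
    by (auto simp: singular_values_def)
  moreover have "finite ?T" using finite_singular_values[of A] by simp
  \<comment> \<open>Membership of the minimum gives its nonnegativity, needed to square the
    inequality.\<close>
  ultimately have "Min ?T \<le> ?s" "Min ?T \<in> ?T"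
    using Min_le[of ?T ?s] Min_in[of ?T] by blast+
  then have "(smallest_nonzero_singular_value A)\<^sup>2 \<le> ?s\<^sup>2"
    by (auto simp: smallest_nonzero_singular_value_def singular_values_def intro: power_mono)
  then show ?thesis using bspec[OF min assms]
    by (meson mult_right_mono order_trans zero_le_power2)
qed simp

subsection \<open>One step of the method\<close>

lemma norm_row_squared: "(norm (row i A))\<^sup>2 = (\<Sum>j\<in>UNIV. (cmod (A $ i $ j))\<^sup>2)"
  by (simp add: norm_vec_def L2_set_def row_def sum_nonneg)

lemma frobenius_norm_squared: "(frobenius_norm A)\<^sup>2 = (\<Sum>i\<in>UNIV. (norm (row i A))\<^sup>2)"
  by (simp add: frobenius_norm_def norm_row_squared sum_nonneg)

lemma norm_column_ctranspose: "norm (column i (ctranspose A)) = norm (row i A)"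
  by (simp add: norm_vec_def L2_set_def row_def column_def ctranspose_def)

text \<open>Orthogonal projection onto the complex line of the conjugated row. At an error vector it
  is the negative of the Kaczmarz correction.\<close>

definition row_projection :: "complex ^ 'n ^ 'm \<Rightarrow> 'm \<Rightarrow> complex ^ 'n \<Rightarrow> complex ^ 'n" where
  "row_projection A i e =
     ((A *v e) $ i / complex_of_real ((norm (row i A))\<^sup>2)) *s column i (ctranspose A)"

lemma row_projection_mem_row_space: "row_projection A i e \<in> column_space (ctranspose A)"
  unfolding row_projection_def by (auto simp: column_space_def simp flip: matrix_vector_mult_axis)

text \<open>The value agrees with \<open>norm_row_projection\<close>; together they make
  \<open>e - p\<close> orthogonal to the projection \<open>p\<close>.\<close>

lemma inner_row_projection:
  "row_projection A i e \<bullet> e = (cmod ((A *v e) $ i))\<^sup>2 / (norm (row i A))\<^sup>2"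
proof -
  let ?r = "(A *v e) $ i" and ?N = "(norm (row i A))\<^sup>2"
  have "row_projection A i e \<bullet> e = axis i (?r / complex_of_real ?N) \<bullet> (A *v e)"
    using inner_ctranspose[of "ctranspose A" "axis i (?r / complex_of_real ?N)" e]
    by (simp add: row_projection_def matrix_vector_mult_axis)
  also have "\<dots> = (?r / complex_of_real ?N) \<bullet> ?r" by (simp add: inner_axis')
  also have "?r / complex_of_real ?N = (1 / ?N) *\<^sub>R ?r"
    by (simp add: scaleR_conv_of_real divide_inverse mult.commute)
  finally show ?thesis by (simp add: power2_norm_eq_inner)
qed

lemma norm_vector_smult: "norm (c *s v) = cmod c * norm (v :: complex ^ 'n)"
  by (simp add: norm_vec_def L2_set_def norm_mult power_mult_distrib real_sqrt_mult
      flip: sum_distrib_left)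

lemma norm_row_projection:
  "(norm (row_projection A i e))\<^sup>2 = (cmod ((A *v e) $ i))\<^sup>2 / (norm (row i A))\<^sup>2"
proof -
  have "norm (row_projection A i e)
      = cmod ((A *v e) $ i) / (norm (row i A))\<^sup>2 * norm (row i A)"
    by (simp add: row_projection_def norm_vector_smult norm_column_ctranspose norm_divide
        norm_power)
  also have "\<dots> = cmod ((A *v e) $ i) / norm (row i A)"
    by (simp add: power2_eq_square)
  finally show ?thesis by (simp add: power_divide)
qed

text \<open>Each squared entry of \<open>A *v e\<close> is a squared row norm times a squared
  projection norm. Replace every projection by the largest; the row weights sum to the squared
  Frobenius norm.\<close>

lemma max_row_projection_bound:
  assumes "\<forall>i. row i A \<noteq> 0"
    and "\<And>j. (norm (row_projection A j e))\<^sup>2 \<le> (norm (row_projection A i e))\<^sup>2"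
  shows "(norm (A *v e))\<^sup>2 \<le> (frobenius_norm A)\<^sup>2 * (norm (row_projection A i e))\<^sup>2"
proof -
  have "(norm (A *v e))\<^sup>2 = (\<Sum>j\<in>UNIV. (cmod ((A *v e) $ j))\<^sup>2)"
    by (simp add: norm_vec_def L2_set_def sum_nonneg)
  also have "\<dots> = (\<Sum>j\<in>UNIV. (norm (row j A))\<^sup>2 * (norm (row_projection A j e))\<^sup>2)"
    using assms(1) by (simp add: norm_row_projection)
  also have "\<dots> \<le> (\<Sum>j\<in>UNIV. (norm (row j A))\<^sup>2 * (norm (row_projection A i e))\<^sup>2)"
    by (intro sum_mono mult_left_mono assms(2)) simp
  finally show ?thesis by (simp add: frobenius_norm_squared sum_distrib_right)
qed

lemma frobenius_norm_pos:
  assumes "\<forall>i. row i A \<noteq> 0"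
  shows "0 < (frobenius_norm A)\<^sup>2"
  unfolding frobenius_norm_squared using assms by (intro sum_pos) auto

lemma greedy_row_projection_bound:
  assumes "\<forall>i. row i A \<noteq> 0"
    and "e \<in> column_space (ctranspose A)"
    and "\<And>j. (norm (row_projection A j e))\<^sup>2 \<le> (norm (row_projection A i e))\<^sup>2"
  shows "(smallest_nonzero_singular_value A)\<^sup>2 / (frobenius_norm A)\<^sup>2 * (norm e)\<^sup>2
    \<le> (norm (row_projection A i e))\<^sup>2"
  using smallest_nonzero_singular_value_bound[OF assms(2)]
    max_row_projection_bound[OF assms(1,3)] frobenius_norm_pos[OF assms(1)]
  by (simp add: field_simps)

lemma norm_row_projection_le: "norm (row_projection A i e) \<le> norm e"
proof -
  have "(norm (row_projection A i e))\<^sup>2 = row_projection A i e \<bullet> e"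
    by (simp add: norm_row_projection inner_row_projection)
  also have "\<dots> \<le> norm (row_projection A i e) * norm e" by (rule norm_cauchy_schwarz)
  finally show ?thesis
    by (cases "norm (row_projection A i e) = 0") (simp_all add: power2_eq_square)
qed

text \<open>Test the greedy bound on a conjugated row, a nonzero vector of the row space, and use
  that projections do not increase norms.\<close>

lemma singular_ratio_le_1:
  fixes A :: "complex ^ 'n ^ 'm"
  assumes "\<forall>i. row i A \<noteq> 0"
  shows "(smallest_nonzero_singular_value A)\<^sup>2 / (frobenius_norm A)\<^sup>2 \<le> 1" (is "?\<rho> \<le> 1")
proof -
  fix i0 :: 'm
  let ?e = "column i0 (ctranspose A)"
  have mem: "?e \<in> column_space (ctranspose A)"
    using matrix_vector_mult_axis[of "ctranspose A" i0 1] by (metis column_space_def rangeI vector_smult_lid)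
  have "?e \<noteq> 0" using assms norm_column_ctranspose[of i0 A] by (metis norm_eq_zero)
  let ?f = "\<lambda>j. (norm (row_projection A j ?e))\<^sup>2"
  have "Max (range ?f) \<in> range ?f" by (rule Max_in) auto
  then obtain i where "Max (range ?f) = ?f i" by (rule rangeE)
  then have "?f j \<le> ?f i" for j
    using Max_ge[of "range ?f" "?f j"] by simp
  from greedy_row_projection_bound[OF assms mem this]
  have "?\<rho> * (norm ?e)\<^sup>2 \<le> 1 * (norm ?e)\<^sup>2"
    using norm_row_projection_le[of A i ?e] by (smt (verit) norm_ge_zero power_mono)
  then show ?thesis
    using \<open>?e \<noteq> 0\<close> by (simp only: mult_le_cancel_right) auto
qed

lemma momentum_step_bound:
  fixes p e f :: "'a :: real_inner"
  assumes p: "p \<bullet> e = p \<bullet> p" and \<rho>: "\<rho> * (norm e)\<^sup>2 \<le> (norm p)\<^sup>2"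
    and \<alpha>: "0 < \<alpha>" "\<alpha> < 2" and \<beta>: "0 < \<beta>" "\<beta> + \<beta>\<^sup>2 \<le> \<alpha>"
  shows "(norm (e - \<alpha> *\<^sub>R p + \<beta> *\<^sub>R (e - f)))\<^sup>2
    \<le> ((1 + 3 * \<beta> + \<beta>\<^sup>2) + (\<alpha>\<^sup>2 - 2 * \<alpha> - \<alpha> * \<beta>) * \<rho>) * (norm e)\<^sup>2
      + (2 * \<beta>\<^sup>2 + (1 + \<alpha>) * \<beta>) * (norm f)\<^sup>2"
proof -
  define q where "q = e - p"
  \<comment> \<open>Chosen so that \<open>\<beta> * s\<close> is the coefficient of
    \<open>f \<bullet> f\<close> left after subtracting \<open>\<beta>\<^sup>2\<close> from
    \<open>2 * \<beta>\<^sup>2 + (1 + \<alpha>) * \<beta>\<close>.\<close>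
  define s where "s = 1 + \<alpha> + \<beta>"
  define w where "w = (1 + \<beta> - \<alpha>) *\<^sub>R p + (1 + \<beta>) *\<^sub>R q"
  have e: "e = p + q" and pq: "p \<bullet> q = 0" "q \<bullet> p = 0"
    using p by (simp_all add: q_def inner_diff_right inner_commute)
  have s: "0 < s" using \<alpha> \<beta> by (simp add: s_def)
  have "0 \<le> (w + s *\<^sub>R f) \<bullet> (w + s *\<^sub>R f)" by simp
  then have "0 \<le> w \<bullet> w + 2 * s * (w \<bullet> f) + s\<^sup>2 * (f \<bullet> f)"
    by (simp add: inner_add_left inner_add_right inner_commute power2_eq_square algebra_simps)
  moreover have "w \<bullet> w \<le> s * ((1 + \<alpha>) * (p \<bullet> p) + q \<bullet> q)"
  proof -
    have "(1 + \<beta> - \<alpha>)\<^sup>2 \<le> s * (1 + \<alpha>)"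
    proof -
      have "\<bar>1 + \<beta> - \<alpha>\<bar> \<le> s" "\<bar>1 + \<beta> - \<alpha>\<bar> \<le> 1 + \<alpha>"
        using \<alpha> \<beta> zero_le_power2[of \<beta>] unfolding s_def by linarith+
      then have "\<bar>1 + \<beta> - \<alpha>\<bar> * \<bar>1 + \<beta> - \<alpha>\<bar> \<le> s * (1 + \<alpha>)" by (intro mult_mono) auto
      then show ?thesis by (simp add: power2_eq_square)
    qed
    \<comment> \<open>This is exactly the hypothesis
      \<open>\<beta> + \<beta>\<^sup>2 \<le> \<alpha>\<close>.\<close>
    moreover have "(1 + \<beta>)\<^sup>2 \<le> s"
      using \<beta> by (simp add: s_def power2_eq_square algebra_simps)
    ultimately have "(1 + \<beta> - \<alpha>)\<^sup>2 * (p \<bullet> p) + (1 + \<beta>)\<^sup>2 * (q \<bullet> q)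
        \<le> s * (1 + \<alpha>) * (p \<bullet> p) + s * (q \<bullet> q)"
      by (intro add_mono mult_right_mono) auto
    moreover have "w \<bullet> w = (1 + \<beta> - \<alpha>)\<^sup>2 * (p \<bullet> p) + (1 + \<beta>)\<^sup>2 * (q \<bullet> q)"
      by (simp add: w_def inner_add_left inner_add_right pq power2_eq_square)
    ultimately show ?thesis by (simp add: algebra_simps)
  qed
  ultimately have "0 \<le> s * ((1 + \<alpha>) * (p \<bullet> p) + q \<bullet> q + 2 * (w \<bullet> f) + s * (f \<bullet> f))"
    by (simp add: power2_eq_square algebra_simps)
  then have "0 \<le> \<beta> * ((1 + \<alpha>) * (p \<bullet> p) + q \<bullet> q + 2 * (w \<bullet> f) + s * (f \<bullet> f))"
    using s \<beta> by (simp add: zero_le_mult_iff)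
  moreover have "(norm (e - \<alpha> *\<^sub>R p + \<beta> *\<^sub>R (e - f)))\<^sup>2
      = (1 + \<beta> - \<alpha>)\<^sup>2 * (p \<bullet> p) + (1 + \<beta>)\<^sup>2 * (q \<bullet> q) - 2 * \<beta> * (w \<bullet> f) + \<beta>\<^sup>2 * (f \<bullet> f)"
  proof -
    have "e - \<alpha> *\<^sub>R p + \<beta> *\<^sub>R (e - f) = w - \<beta> *\<^sub>R f"
      by (simp add: w_def e algebra_simps)
    moreover have "(norm (w - \<beta> *\<^sub>R f))\<^sup>2 = w \<bullet> w - 2 * \<beta> * (w \<bullet> f) + \<beta>\<^sup>2 * (f \<bullet> f)"
      using norm_add_scaleR_squared[of w "- \<beta>" f]
      by (simp add: power2_norm_eq_inner[symmetric])
    moreover have "w \<bullet> w = (1 + \<beta> - \<alpha>)\<^sup>2 * (p \<bullet> p) + (1 + \<beta>)\<^sup>2 * (q \<bullet> q)"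
      by (simp add: w_def inner_add_left inner_add_right pq power2_eq_square)
    ultimately show ?thesis by simp
  qed
  moreover have "(2 * \<alpha> - \<alpha>\<^sup>2 + \<alpha> * \<beta>) * (\<rho> * (norm e)\<^sup>2) \<le> (2 * \<alpha> - \<alpha>\<^sup>2 + \<alpha> * \<beta>) * (p \<bullet> p)"
  proof (rule mult_left_mono)
    have "0 \<le> \<alpha> * (2 - \<alpha>) + \<alpha> * \<beta>" using \<alpha> \<beta> by simp
    then show "0 \<le> 2 * \<alpha> - \<alpha>\<^sup>2 + \<alpha> * \<beta>" by (simp add: power2_eq_square algebra_simps)
  qed (use \<rho> in \<open>simp add: power2_norm_eq_inner\<close>)
  moreover have "(norm e)\<^sup>2 = p \<bullet> p + q \<bullet> q"
    by (simp add: e power2_norm_eq_inner inner_add_left inner_add_right pq)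
  \<comment> \<open>With \<open>p \<bullet> p\<close> in place of
    \<open>\<rho> * (norm e)\<^sup>2\<close>, the claimed bound exceeds the new squared error by
    \<open>\<beta>\<close> times the quantity just shown nonnegative.\<close>
  moreover have "(1 + 3 * \<beta> + \<beta>\<^sup>2) * (p \<bullet> p + q \<bullet> q) - (2 * \<alpha> - \<alpha>\<^sup>2 + \<alpha> * \<beta>) * (p \<bullet> p)
        + (2 * \<beta>\<^sup>2 + (1 + \<alpha>) * \<beta>) * (f \<bullet> f)
      = (1 + \<beta> - \<alpha>)\<^sup>2 * (p \<bullet> p) + (1 + \<beta>)\<^sup>2 * (q \<bullet> q) - 2 * \<beta> * (w \<bullet> f) + \<beta>\<^sup>2 * (f \<bullet> f)
        + \<beta> * ((1 + \<alpha>) * (p \<bullet> p) + q \<bullet> q + 2 * (w \<bullet> f) + s * (f \<bullet> f))"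
    by (simp add: s_def power2_eq_square algebra_simps)
  moreover have "((1 + 3 * \<beta> + \<beta>\<^sup>2) + (\<alpha>\<^sup>2 - 2 * \<alpha> - \<alpha> * \<beta>) * \<rho>) * (norm e)\<^sup>2
      = (1 + 3 * \<beta> + \<beta>\<^sup>2) * (norm e)\<^sup>2 - (2 * \<alpha> - \<alpha>\<^sup>2 + \<alpha> * \<beta>) * (\<rho> * (norm e)\<^sup>2)"
    by (simp add: algebra_simps)
  ultimately show ?thesis
    by (simp only: power2_norm_eq_inner[of f])
qed

lemma mMWRK_error_recurrence:
  assumes run: "mMWRK A b \<alpha> \<beta> x" and rows: "\<forall>i. row i A \<noteq> 0" and sol: "A *v z = b"
    and \<alpha>: "0 < \<alpha>" "\<alpha> < 2" and \<beta>: "0 < \<beta>" "\<beta> + \<beta>\<^sup>2 \<le> \<alpha>"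
    and \<rho>: "\<rho> = (smallest_nonzero_singular_value A)\<^sup>2 / (frobenius_norm A)\<^sup>2"
    and z: "z \<in> column_space (ctranspose A)"
    and init: "x 0 \<in> column_space (ctranspose A)" "x 1 \<in> column_space (ctranspose A)"
  shows "(norm (x (k + 2) - z))\<^sup>2
    \<le> ((1 + 3 * \<beta> + \<beta>\<^sup>2) + (\<alpha>\<^sup>2 - 2 * \<alpha> - \<alpha> * \<beta>) * \<rho>) * (norm (x (k + 1) - z))\<^sup>2
      + (2 * \<beta>\<^sup>2 + (1 + \<alpha>) * \<beta>) * (norm (x k - z))\<^sup>2"
proof -
  let ?S = "column_space (ctranspose A)"
  have S: "subspace ?S" by (rule subspace_column_space)
  \<comment> \<open>Residuals become images of errors, so maximizing the weighted residual maximizes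
    the projection of the error.\<close>
  have residual: "b $ i - (A *v y) $ i = - (A *v (y - z)) $ i" for i y
    using sol by (simp add: linear_diff[OF linear_complex_matrix])
  have step: "\<exists>i. (\<forall>j. (norm (row_projection A j (x (k + 1) - z)))\<^sup>2
        \<le> (norm (row_projection A i (x (k + 1) - z)))\<^sup>2)
      \<and> x (k + 2) = x (k + 1) - \<alpha> *\<^sub>R row_projection A i (x (k + 1) - z) + \<beta> *\<^sub>R (x (k + 1) - x k)"
    for k
  proof -
    obtain i where i: "is_arg_max (weighted_residual A b (x (k + 1))) (\<lambda>i. i \<in> UNIV) i"
      "x (k + 1 + 1) = x (k + 1)
          + \<alpha> *\<^sub>R (((b $ i - (A *v x (k + 1)) $ i) / complex_of_real ((norm (row i A))\<^sup>2))
                     *s column i (ctranspose A))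
          + \<beta> *\<^sub>R (x (k + 1) - x (k + 1 - 1))"
      using run unfolding mMWRK_def by (meson le_add2)
    have weights: "weighted_residual A b (x (k + 1)) j = (norm (row_projection A j (x (k + 1) - z)))\<^sup>2" for j
      by (simp only: weighted_residual_def residual norm_row_projection norm_minus_cancel)
    have "((b $ i - (A *v x (k + 1)) $ i) / complex_of_real ((norm (row i A))\<^sup>2))
        *s column i (ctranspose A) = - row_projection A i (x (k + 1) - z)"
      by (simp only: residual row_projection_def) (simp add: vec_eq_iff)
    note i(2)[unfolded this]
    then have "x (k + 2) = x (k + 1) - \<alpha> *\<^sub>R row_projection A i (x (k + 1) - z)
        + \<beta> *\<^sub>R (x (k + 1) - x k)"
      by simp
    moreover have "(norm (row_projection A j (x (k + 1) - z)))\<^sup>2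
        \<le> (norm (row_projection A i (x (k + 1) - z)))\<^sup>2" for j
      using i(1) unfolding is_arg_max_linorder weights by blast
    ultimately show ?thesis by blast
  qed
  \<comment> \<open>The momentum term involves two iterates, so the induction carries a consecutive
    pair.\<close>
  have mem: "x k \<in> ?S \<and> x (k + 1) \<in> ?S" for k
  proof (induction k)
    case (Suc k)
    then show ?case
      using step[of k] S row_projection_mem_row_space
      by (auto intro!: subspace_add subspace_diff subspace_scale)
  qed (use init in simp)
  obtain i where max: "\<And>j. (norm (row_projection A j (x (k + 1) - z)))\<^sup>2
        \<le> (norm (row_projection A i (x (k + 1) - z)))\<^sup>2"
    and x: "x (k + 2) = x (k + 1) - \<alpha> *\<^sub>R row_projection A i (x (k + 1) - z) + \<beta> *\<^sub>R (x (k + 1) - x k)"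
    using step by blast
  let ?p = "row_projection A i (x (k + 1) - z)"
  have "x (k + 2) - z = (x (k + 1) - z) - \<alpha> *\<^sub>R ?p + \<beta> *\<^sub>R ((x (k + 1) - z) - (x k - z))"
    unfolding x by simp
  moreover have "?p \<bullet> (x (k + 1) - z) = ?p \<bullet> ?p"
    by (simp add: inner_row_projection norm_row_projection flip: power2_norm_eq_inner)
  moreover have "\<rho> * (norm (x (k + 1) - z))\<^sup>2 \<le> (norm ?p)\<^sup>2"
    unfolding \<rho> using mem z S max by (intro greedy_row_projection_bound rows subspace_diff) auto
  ultimately show ?thesis
    using momentum_step_bound[OF _ _ \<alpha> \<beta>] by metis
qed

subsection \<open>Two-step recurrences\<close>

text \<open>\<open>q\<close> and \<open>- d\<close> are the roots of
  \<open>t\<^sup>2 = a * t + c\<close>. Hence \<open>F (k + 1) + d * F k\<close> shrinks by the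
  factor \<open>q\<close> at each step; its initial value is \<open>(1 + d) * F 0\<close> because
  \<open>F 0 = F 1\<close>.\<close>

lemma two_step_recurrence_bound:
  fixes F :: "nat \<Rightarrow> real" and a c :: real
  defines "q \<equiv> (sqrt (a\<^sup>2 + 4 * c) + a) / 2" and "d \<equiv> (sqrt (a\<^sup>2 + 4 * c) - a) / 2"
  assumes rec: "\<And>k. F (k + 2) \<le> a * F (k + 1) + c * F k"
    and "\<And>k. 0 \<le> F k" and "F 0 = F 1" and "0 \<le> c"
  shows "F (k + 1) \<le> q ^ k * (1 + d) * F 0"
proof -
  have "\<bar>a\<bar> \<le> sqrt (a\<^sup>2 + 4 * c)" using \<open>0 \<le> c\<close> by (intro real_le_rsqrt) simp
  then have nn: "0 \<le> q" "0 \<le> d" by (auto simp: q_def d_def)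
  have "q * d = ((sqrt (a\<^sup>2 + 4 * c))\<^sup>2 - a\<^sup>2) / 4"
    by (simp add: q_def d_def power2_eq_square algebra_simps)
  then have c: "c = q * d" using \<open>0 \<le> c\<close> by simp
  have a: "a = q - d" by (simp add: q_def d_def field_simps)
  have "F (k + 1) + d * F k \<le> q ^ k * ((1 + d) * F 0)"
  proof (induction k)
    case (Suc k)
    have "F (k + 2) + d * F (k + 1) \<le> q * (F (k + 1) + d * F k)"
      using rec[of k] by (simp add: a c algebra_simps)
    also have "\<dots> \<le> q * (q ^ k * ((1 + d) * F 0))"
      by (rule mult_left_mono[OF Suc nn(1)])
    finally show ?case by (simp add: mult.assoc)
  qed (use \<open>F 0 = F 1\<close> in \<open>simp add: algebra_simps\<close>)
  moreover have "0 \<le> d * F k" using nn assms(4) by simp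
  ultimately show ?thesis by (simp add: mult.assoc)
qed

text \<open>\<open>(2 - a)\<^sup>2\<close> exceeds \<open>a\<^sup>2 + 4 * c\<close> by
  \<open>4 * (1 - a - c)\<close>, and \<open>2 - a\<close> is positive.\<close>

lemma two_step_factor_less_1:
  fixes a c :: real
  assumes "a + c < 1" "0 \<le> c"
  shows "(sqrt (a\<^sup>2 + 4 * c) + a) / 2 < 1"
proof -
  have "sqrt (a\<^sup>2 + 4 * c) < 2 - a"
    using assms by (intro real_less_lsqrt) (simp_all add: power2_eq_square algebra_simps)
  then show ?thesis by simp
qed

text \<open>The upper bound on \<open>x\<close> is the larger root of
  \<open>3 * t\<^sup>2 + u * t - v\<close>; positivity of \<open>6 * x + u\<close> permits
  squaring.\<close>

lemma less_positive_root_imp: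
  fixes x u v :: real
  assumes "0 < x" "0 < u" "x < (sqrt (u\<^sup>2 + 12 * v) - u) / 6"
  shows "3 * x\<^sup>2 + u * x < v"
proof -
  have "6 * x + u < sqrt (u\<^sup>2 + 12 * v)" using assms by simp
  then have "(6 * x + u)\<^sup>2 < u\<^sup>2 + 12 * v"
    using assms by (metis add_pos_pos less_eq_real_def mult_pos_pos real_less_rsqrt
        linorder_not_le real_le_lsqrt zero_less_numeral)
  then show ?thesis by (simp add: power2_eq_square algebra_simps)
qed

theorem mainTheorem3:
  fixes A :: "complex ^ 'n ^ 'm" and b :: "complex ^ 'm" and xstar :: "complex ^ 'n"
    and \<alpha> \<beta> \<rho> \<tau>1 \<tau>2 \<gamma>1 \<gamma>2 :: real
  assumes no_zero_rows: "\<forall>i. row i A \<noteq> 0"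
    and consistent: "\<exists>x. A *v x = b"
    and xstar: "xstar = pseudoinverse A *v b"
    and rho: "\<rho> = (smallest_nonzero_singular_value A)\<^sup>2 / (frobenius_norm A)\<^sup>2"
    and alpha: "0 < \<alpha>" "\<alpha> < 2"
    and tau1: "\<tau>1 = 4 + \<alpha> - \<alpha> * \<rho>"
    and tau2: "\<tau>2 = \<alpha> * (2 - \<alpha>) * \<rho>"
    and beta: "0 < \<beta>" "\<beta> < (sqrt (\<tau>1\<^sup>2 + 12 * \<tau>2) - \<tau>1) / 6"
    and gamma1: "\<gamma>1 = (1 + 3 * \<beta> + \<beta>\<^sup>2) + (\<alpha>\<^sup>2 - 2 * \<alpha> - \<alpha> * \<beta>) * \<rho>"
    and gamma2: "\<gamma>2 = 2 * \<beta>\<^sup>2 + (1 + \<alpha>) * \<beta>"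
  shows "\<gamma>1 + \<gamma>2 < 1 \<and>
    (\<forall>x. mMWRK A b \<alpha> \<beta> x \<and> x 0 = x 1 \<and> x 0 \<in> column_space (ctranspose A) \<longrightarrow>
      (\<forall>k. (norm (x (k + 1) - xstar))\<^sup>2
         \<le> ((sqrt (\<gamma>1\<^sup>2 + 4 * \<gamma>2) + \<gamma>1) / 2) ^ k
            * (1 + (sqrt (\<gamma>1\<^sup>2 + 4 * \<gamma>2) - \<gamma>1) / 2) * (norm (x 0 - xstar))\<^sup>2)) \<and>
    (sqrt (\<gamma>1\<^sup>2 + 4 * \<gamma>2) + \<gamma>1) / 2 < 1"
proof -
  have rho_bounds: "0 \<le> \<rho>" "\<rho> \<le> 1"
    using singular_ratio_le_1[OF no_zero_rows] by (simp_all add: rho)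
  have "\<alpha> * \<rho> \<le> \<alpha>" using alpha rho_bounds by (simp add: mult_left_le)
  then have tau1_ge: "4 \<le> \<tau>1" by (simp add: tau1)
  have beta_less: "3 * \<beta>\<^sup>2 + \<tau>1 * \<beta> < \<tau>2"
    using less_positive_root_imp beta tau1_ge by simp
  \<comment> \<open>\<open>\<gamma>1 + \<gamma>2 - 1\<close> equals
    \<open>3 * \<beta>\<^sup>2 + \<tau>1 * \<beta> - \<tau>2\<close>.\<close>
  then have sum: "\<gamma>1 + \<gamma>2 < 1"
    by (simp add: gamma1 gamma2 tau1 tau2 power2_eq_square algebra_simps)
  have gamma2_nonneg: "0 \<le> \<gamma>2" using alpha beta by (simp add: gamma2)
  \<comment> \<open>From \<open>\<rho> \<le> 1\<close>,
    \<open>4 * \<beta> + 3 * \<beta>\<^sup>2 < 2 * \<alpha>\<close>, and the left side is at least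
    \<open>2 * (\<beta> + \<beta>\<^sup>2)\<close>.\<close>
  have beta_alpha: "\<beta> + \<beta>\<^sup>2 \<le> \<alpha>"
  proof -
    have "4 * \<beta> \<le> \<tau>1 * \<beta>" using tau1_ge beta by simp
    moreover have "\<tau>2 \<le> \<alpha> * (2 - \<alpha>)"
      using alpha rho_bounds unfolding tau2 by (simp add: mult_left_le)
    moreover have "\<alpha> * (2 - \<alpha>) \<le> \<alpha> * 2" using alpha by simp
    ultimately show ?thesis using beta_less beta zero_le_power2[of \<beta>] by linarith
  qed
  have "(norm (x (k + 1) - xstar))\<^sup>2
      \<le> ((sqrt (\<gamma>1\<^sup>2 + 4 * \<gamma>2) + \<gamma>1) / 2) ^ k
        * (1 + (sqrt (\<gamma>1\<^sup>2 + 4 * \<gamma>2) - \<gamma>1) / 2) * (norm (x 0 - xstar))\<^sup>2"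
    if "mMWRK A b \<alpha> \<beta> x" "x 0 = x 1" "x 0 \<in> column_space (ctranspose A)" for x k
  proof (rule two_step_recurrence_bound)
    obtain y where "A *v y = b" using consistent by blast
    then have "A *v xstar = b" unfolding xstar by (rule pseudoinverse_solves)
    moreover have "xstar \<in> column_space (ctranspose A)"
      unfolding xstar by (rule pseudoinverse_mem_row_space)
    ultimately show "(norm (x (k + 2) - xstar))\<^sup>2
        \<le> \<gamma>1 * (norm (x (k + 1) - xstar))\<^sup>2 + \<gamma>2 * (norm (x k - xstar))\<^sup>2" for k
      unfolding gamma1 gamma2
      using mMWRK_error_recurrence[OF that(1) no_zero_rows _ alpha beta(1) beta_alpha rho] that
      by simp
  qed (use that gamma2_nonneg in simp_all)
  then show ?thesis
    using sum two_step_factor_less_1[OF sum gamma2_nonneg] by blast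
qed

end
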